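(* Let $p$ be an odd prime with $p \equiv 3 \pmod 4$, let $k \geq 1$ be an integer, and let $t \in \mathbb{Z}_{p^k}$. If $t \neq 0$, write $t = p^{\alpha}\beta$ where $p \nmid \beta$ and $0 \le \alpha < k$. Then $$ N_{2}(t, p^k) = \begin{cases} p^{2 \lfloor \frac{k}{2} \rfloor} & \text{if } t = 0, \\ (p + 1)p^{k-1} & \text{if } t \neq 0 \text{ and } \alpha \text{ is even}, \\ 0 & \text{if } t \neq 0 \text{ and } \alpha \text{ is odd}. \end{cases} $$
   Context: $\mathbb{Z}_n$ denotes the ring of integers modulo $n$. For $t \in \mathbb{Z}_n$, $N_2(t,n)$ is the number of ordered pairs $(x_1,x_2) \in \mathbb{Z}_n^2$ with $x_1^2+x_2^2 \equiv t \pmod n$ (zero entries are allowed). In the factorization $t = p^{\alpha}\beta$ the element $t$ is represented by a nonzero integer in $\{1,\dots,p^k-1\}$. $\lfloor x\rfloor$ is the floor of $x$. *)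

theory Defs
  imports "HOL-Number_Theory.Number_Theory"
begin

text \<open>Elements of the ring of integers modulo \<open>n\<close> are their least nonnegative representatives,
  the carrier of the library's \<open>residue_ring\<close> being \<open>{0..n - 1}\<close>.\<close>

definition N2 :: "int \<Rightarrow> nat \<Rightarrow> nat" where
  "N2 t n = card {(x1, x2). x1 \<in> carrier (residue_ring (int n)) \<and>
                            x2 \<in> carrier (residue_ring (int n)) \<and>
                            [x1\<^sup>2 + x2\<^sup>2 = t] (mod int n)}"

end

theory Submission
  imports Defs
begin

text \<open>
  Write \<open>x\<^sup>2 + y\<^sup>2\<close> as the norm of the Gaussian integer \<open>x + iy\<close>. Since \<open>p \<equiv> 3 (mod 4)\<close>, \<open>- 1\<close> is not
  a square modulo \<open>p\<close>, so \<open>p\<close> stays prime in the Gaussian integers: \<open>p\<close> divides \<open>x\<^sup>2 + y\<^sup>2\<close> only if it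
  divides both \<open>x\<close> and \<open>y\<close> (\<open>dvd_sum_squares_iff\<close>). The theorem follows from two consequences of this.

  When \<open>p\<close> does not divide \<open>t\<close>, the solutions for \<open>t\<close> form a fibre of the norm map from the units of
  \<open>\<int>[i] / p\<^sup>k\<close> to the units of \<open>\<int> / p\<^sup>k\<close>. This map is onto (\<open>unit_sum_two_squares\<close>), and multiplying by an
  element of norm \<open>c\<close> carries the fibre over \<open>u\<close> into the fibre over \<open>c u\<close>, so all fibres have the
  same size (\<open>card_sols_unit_eq\<close>). There are \<open>p\<^bsup>2k\<^esup> - p\<^bsup>2k-2\<^esup>\<close> units above and \<open>p\<^sup>k - p\<^bsup>k-1\<^esup>\<close> below, and the
  quotient is \<open>(p + 1) p\<^bsup>k-1\<^esup>\<close> (\<open>card_sols_unit\<close>). Working modulo \<open>p\<^sup>k\<close> from the start avoids Hensel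
  lifting: Euler's criterion, in the form that of \<open>t\<close> and \<open>- t\<close> one is a square, holds modulo \<open>p\<^sup>k\<close>
  because \<open>\<phi>(p\<^sup>k) / 2\<close> is odd.

  When \<open>p\<close> divides \<open>t\<close> and \<open>k \<ge> 2\<close>, every solution is \<open>p\<close> times a pair, so \<open>t\<close> must be divisible by \<open>p\<^sup>2\<close> modulo
  \<open>p\<^sup>k\<close>, and dividing by \<open>p\<^sup>2\<close> gives \<open>N\<^sub>2(p\<^sup>2 s, p\<^sup>2 n) = p\<^sup>2 N\<^sub>2(s, n)\<close> (\<open>card_sols_scale\<close>). Repeating this ends
  at a unit \<open>t\<close> if \<open>\<alpha>\<close> is even, at a \<open>t\<close> exactly divisible by \<open>p\<close> if \<open>\<alpha>\<close> is odd, and at the modulus \<open>1\<close>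
  or \<open>p\<close> if \<open>t = 0\<close>.
\<close>

section \<open>Solution sets and multiplication by a Gaussian integer\<close>

definition sols :: "int \<Rightarrow> nat \<Rightarrow> (int \<times> int) set" where
  "sols t n = {(x, y). x \<in> {0..<int n} \<and> y \<in> {0..<int n} \<and> [x\<^sup>2 + y\<^sup>2 = t] (mod int n)}"

lemma N2_eq_card_sols: "N2 t n = card (sols t n)"
proof -
  have "carrier (residue_ring (int n)) = {0..<int n}"
    by (auto simp: residue_ring_def)
  then show ?thesis by (simp add: N2_def sols_def)
qed

lemma finite_sols [simp]: "finite (sols t n)"
  by (rule finite_subset[of _ "{0..<int n} \<times> {0..<int n}"]) (auto simp: sols_def)

lemma sols_cong: "[t = t'] (mod int n) \<Longrightarrow> sols t n = sols t' n"
  by (auto simp: sols_def cong_def)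

text \<open>The injection is multiplication by \<open>a + i b\<close>. It is injective because multiplying further by the
  conjugate \<open>a - i b\<close> multiplies both coordinates by the unit \<open>c\<close>.\<close>

lemma card_sols_le_mult_norm:
  assumes "n > 0" and c: "[a\<^sup>2 + b\<^sup>2 = c] (mod int n)" "coprime c (int n)"
  shows "card (sols t n) \<le> card (sols (c * t) n)"
proof (rule card_inj_on_le)
  define f where "f = (\<lambda>(x, y). ((a * x - b * y) mod int n, (a * y + b * x) mod int n))"
  show "inj_on f (sols t n)"
  proof (rule inj_onI, clarify)
    fix x y x' y'
    assume xy: "(x, y) \<in> sols t n" "(x', y') \<in> sols t n" and eq: "f (x, y) = f (x', y')"
    have d1: "int n dvd (a * x - b * y) - (a * x' - b * y')"
      and d2: "int n dvd (a * y + b * x) - (a * y' + b * x')"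
      using eq by (simp_all add: f_def mod_eq_dvd_iff)
    have cop: "coprime (int n) (a\<^sup>2 + b\<^sup>2)"
      using cong_imp_coprime[OF cong_sym[OF c(1)] c(2)] by (simp add: coprime_commute)
    \<comment> \<open>The two combinations below are the real and imaginary parts of the product of the conjugate
      \<open>a - i b\<close> with the difference of the two images.\<close>
    have "int n dvd a * ((a * x - b * y) - (a * x' - b * y')) + b * ((a * y + b * x) - (a * y' + b * x'))"
      using d1 d2 by (intro dvd_add dvd_mult)
    also have "\<dots> = (a\<^sup>2 + b\<^sup>2) * (x - x')" by (simp add: power2_eq_square algebra_simps)
    finally have 1: "int n dvd x - x'" using cop by (simp add: coprime_dvd_mult_right_iff)
    have "int n dvd a * ((a * y + b * x) - (a * y' + b * x')) - b * ((a * x - b * y) - (a * x' - b * y'))"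
      by (rule dvd_diff[OF dvd_mult[OF d2] dvd_mult[OF d1]])
    also have "\<dots> = (a\<^sup>2 + b\<^sup>2) * (y - y')" by (simp add: power2_eq_square algebra_simps)
    finally have 2: "int n dvd y - y'" using cop by (simp add: coprime_dvd_mult_right_iff)
    have "x mod int n = x' mod int n" "y mod int n = y' mod int n"
      using 1 2 by (simp_all add: mod_eq_dvd_iff)
    moreover have "x \<in> {0..<int n}" "y \<in> {0..<int n}" "x' \<in> {0..<int n}" "y' \<in> {0..<int n}"
      using xy unfolding sols_def by blast+
    ultimately show "x = x' \<and> y = y'" by simp
  qed
  show "f ` sols t n \<subseteq> sols (c * t) n"
  proof (rule image_subsetI)
    fix z assume "z \<in> sols t n"
    moreover obtain x y where "z = (x, y)" by fastforce
    moreover obtain x' y' where "f (x, y) = (x', y')" by fastforce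
    ultimately have xy: "(x, y) \<in> sols t n" and f: "f (x, y) = (x', y')" and fz: "f z = (x', y')"
      by simp_all
    have f': "x' = (a * x - b * y) mod int n" "y' = (a * y + b * x) mod int n"
      using f unfolding f_def by simp_all
    have "[x'\<^sup>2 + y'\<^sup>2 = (a * x - b * y)\<^sup>2 + (a * y + b * x)\<^sup>2] (mod int n)"
      unfolding f' by (intro cong_add cong_pow cong_mod_leftI cong_refl)
    also have "(a * x - b * y)\<^sup>2 + (a * y + b * x)\<^sup>2 = (a\<^sup>2 + b\<^sup>2) * (x\<^sup>2 + y\<^sup>2)"
      by (simp add: power2_eq_square algebra_simps)
    also have "[\<dots> = c * t] (mod int n)"
      using xy c by (intro cong_mult) (auto simp: sols_def)
    finally show "f z \<in> sols (c * t) n"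
      using \<open>n > 0\<close> by (simp add: fz sols_def f')
  qed
qed simp

section \<open>Squares modulo powers of a prime congruent to 3 modulo 4\<close>

locale prime_3_mod_4 =
  fixes p :: nat
  assumes prime: "prime p" and mod4: "[p = 3] (mod 4)"
begin

lemma p_gt_2: "p > 2"
proof -
  have "p mod 4 = 3" using mod4 by (simp add: cong_def)
  then show ?thesis using mod_less_eq_dividend[of p 4] by linarith
qed

lemma prime_int: "prime (int p)"
  using prime by simp

lemma not_dvd_2: "\<not> int p dvd 2"
  using p_gt_2 by (auto dest: zdvd_imp_le)

lemma coprime_power_iff:
  assumes "k > 0"
  shows "coprime t (int (p ^ k)) \<longleftrightarrow> \<not> int p dvd t"
proof -
  have "coprime t (int (p ^ k)) \<longleftrightarrow> coprime (int p) t"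
    using assms by (simp add: coprime_commute)
  also have "\<dots> \<longleftrightarrow> \<not> int p dvd t"
    using prime_imp_coprime[OF prime_int] coprime_common_divisor[of "int p" t "int p"] p_gt_2 by auto
  finally show ?thesis .
qed

lemma cong_power_imp_cong:
  assumes "[x = y] (mod int (p ^ k))" "k > 0"
  shows "[x = y] (mod int p)"
  using assms(1) by (rule cong_dvd_modulus) (use assms(2) in simp)

lemma euler_prime_power:
  assumes "k > 0" "\<not> int p dvd z"
  shows "[z ^ totient (p ^ k) = 1] (mod int (p ^ k))"
proof -
  have "p ^ k > 1" using p_gt_2 assms(1) by (intro one_less_power) auto
  then have "residues (int (p ^ k))" by unfold_locales linarith
  moreover have "coprime z (int (p ^ k))" using assms by (simp only: coprime_power_iff not_False_eq_True)
  ultimately show ?thesis using residues.euler_theorem[of "int (p ^ k)" z] by (simp only: nat_int)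
qed

lemma odd_half: obtains h where "p - 1 = 2 * h" "odd h"
proof -
  have "p mod 4 = 3" using mod4 by (simp add: cong_def)
  then have "p - 1 = 2 * (2 * (p div 4) + 1)" by presburger
  then show ?thesis by (rule that) simp
qed

text \<open>If \<open>p\<close> did not divide \<open>x\<close>, raising \<open>y\<^sup>2 \<equiv> - x\<^sup>2\<close> to the odd power \<open>(p - 1) / 2\<close> would give
  \<open>1 \<equiv> - 1\<close> by Fermat's little theorem.\<close>

lemma dvd_sum_squares_imp_dvd:
  assumes "int p dvd x\<^sup>2 + y\<^sup>2"
  shows "int p dvd x"
proof (rule ccontr)
  assume nx: "\<not> int p dvd x"
  then have ny: "\<not> int p dvd y"
    using assms by (auto simp: prime_dvd_power_int_iff[OF prime_int] dvd_add_left_iff)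
  obtain h where h: "p - 1 = 2 * h" "odd h" by (rule odd_half)
  have fermat: "[z ^ (p - 1) = 1] (mod int p)" if "\<not> int p dvd z" for z
    using euler_prime_power[of 1 z] that prime by (simp add: totient_prime)
  have "[y\<^sup>2 = - (x\<^sup>2)] (mod int p)"
    using assms by (simp add: cong_iff_dvd_diff add.commute)
  then have "[(y\<^sup>2) ^ h = (- (x\<^sup>2)) ^ h] (mod int p)" by (rule cong_pow)
  then have "[y ^ (p - 1) = - (x ^ (p - 1))] (mod int p)"
    using h by (simp add: power_mult)
  moreover have "[- (x ^ (p - 1)) = - 1] (mod int p)"
    using fermat[OF nx] by (simp add: cong_minus_minus_iff)
  ultimately have "[1 = - 1] (mod int p)"
    using fermat[OF ny] by (meson cong_sym cong_trans)
  then have "int p dvd 2" by (simp add: cong_iff_dvd_diff)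
  then show False using not_dvd_2 by simp
qed

lemma dvd_sum_squares_iff: "int p dvd x\<^sup>2 + y\<^sup>2 \<longleftrightarrow> int p dvd x \<and> int p dvd y"
proof
  assume "int p dvd x\<^sup>2 + y\<^sup>2"
  then show "int p dvd x \<and> int p dvd y"
    using dvd_sum_squares_imp_dvd[of x y] dvd_sum_squares_imp_dvd[of y x] by (simp add: add.commute)
next
  assume "int p dvd x \<and> int p dvd y"
  then show "int p dvd x\<^sup>2 + y\<^sup>2"
    unfolding power2_eq_square by (intro dvd_add dvd_mult) simp_all
qed

text \<open>Put \<open>m = \<phi>(p\<^sup>k) / 2\<close>, an odd number. By Euler's theorem \<open>(t\<^sup>m)\<^sup>2 \<equiv> 1\<close>, hence \<open>t\<^sup>m \<equiv> \<plusminus>1\<close>, and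
  multiplying by \<open>t\<close> exhibits \<open>\<plusminus>t\<close> as the even power \<open>t\<^bsup>m+1\<^esup>\<close>.\<close>

lemma unit_or_minus_unit_square:
  assumes "k > 0" "\<not> int p dvd t"
  shows "\<exists>s. [t = s\<^sup>2] (mod int (p ^ k)) \<or> [- t = s\<^sup>2] (mod int (p ^ k))"
proof -
  obtain h where h: "p - 1 = 2 * h" "odd h" by (rule odd_half)
  define m where "m = p ^ (k - 1) * h"
  have "odd p" using prime p_gt_2 by (rule prime_odd_nat)
  then have "odd m" using h by (simp add: m_def)
  then have "even (m + 1)" by simp
  then obtain j where j: "m + 1 = 2 * j" by (rule evenE)
  have "[t ^ totient (p ^ k) = 1] (mod int (p ^ k))"
    using assms by (rule euler_prime_power)
  also have "totient (p ^ k) = m * 2"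
    using totient_prime_power[OF prime assms(1)] unfolding m_def h(1) by (simp only: mult_ac)
  finally have "int p ^ k dvd (t ^ m)\<^sup>2 - 1"
    by (simp only: cong_iff_dvd_diff power_mult of_nat_power)
  also have "(t ^ m)\<^sup>2 - 1 = (t ^ m - 1) * (t ^ m + 1)"
    by (simp only: power2_eq_square square_diff_one_factored mult.commute)
  finally have prod: "int p ^ k dvd (t ^ m - 1) * (t ^ m + 1)" .
  have "(t ^ j)\<^sup>2 = t ^ (m + 1)"
    unfolding j by (simp only: mult.commute[of 2] power_mult)
  then have sq: "(t ^ j)\<^sup>2 = t ^ m * t" by (simp add: mult.commute)
  \<comment> \<open>The two factors differ by \<open>2\<close>, so \<open>p\<close> divides at most one and \<open>p\<^sup>k\<close> divides the other.\<close>
  have "\<not> (int p dvd t ^ m - 1 \<and> int p dvd t ^ m + 1)"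
  proof
    assume "int p dvd t ^ m - 1 \<and> int p dvd t ^ m + 1"
    then have "int p dvd (t ^ m + 1) - (t ^ m - 1)" by (elim conjE) (rule dvd_diff)
    also have "(t ^ m + 1) - (t ^ m - 1) = 2" by linarith
    finally show False using not_dvd_2 by contradiction
  qed
  then have "coprime (t ^ m - 1) (int p ^ k) \<or> coprime (t ^ m + 1) (int p ^ k)"
    unfolding of_nat_power[symmetric] coprime_power_iff[OF assms(1)] by blast
  then have "int p ^ k dvd t ^ m - 1 \<or> int p ^ k dvd t ^ m + 1"
  proof
    assume "coprime (t ^ m - 1) (int p ^ k)"
    then have "coprime (int p ^ k) (t ^ m - 1)" by (subst coprime_commute)
    then show ?thesis using prod by (simp add: coprime_dvd_mult_right_iff)
  next
    assume "coprime (t ^ m + 1) (int p ^ k)"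
    then have "coprime (int p ^ k) (t ^ m + 1)" by (subst coprime_commute)
    then show ?thesis using prod by (simp add: coprime_dvd_mult_left_iff)
  qed
  then show ?thesis
  proof
    assume "int p ^ k dvd t ^ m - 1"
    then have "int p ^ k dvd (t ^ m - 1) * t" by (rule dvd_mult2)
    then have "[(t ^ j)\<^sup>2 = t] (mod int (p ^ k))"
      by (simp only: sq cong_iff_dvd_diff left_diff_distrib mult_1 of_nat_power)
    then show ?thesis by (intro exI disjI1) (rule cong_sym)
  next
    assume "int p ^ k dvd t ^ m + 1"
    then have "int p ^ k dvd (t ^ m + 1) * t" by (rule dvd_mult2)
    then have "[(t ^ j)\<^sup>2 = - t] (mod int (p ^ k))"
      by (simp only: sq cong_iff_dvd_diff distrib_right mult_1 of_nat_power diff_minus_eq_add)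
    then show ?thesis by (intro exI disjI2) (rule cong_sym)
  qed
qed

text \<open>Let \<open>m\<close> be the least non-square modulo \<open>p\<close>, so that \<open>m - 1\<close> is a square. By the preceding
  dichotomy \<open>m - 1\<close> and \<open>- m\<close> are squares modulo \<open>p\<^sup>k\<close>, and they add up to \<open>- 1\<close>.\<close>

lemma minus_one_sum_two_squares:
  assumes "k > 0"
  shows "\<exists>r s. [r\<^sup>2 + s\<^sup>2 = - 1] (mod int (p ^ k))"
proof -
  define sq where "sq = (\<lambda>m::nat. \<exists>x. [int m = x\<^sup>2] (mod int p))"
  have nsq: "\<not> sq (p - 1)"
  proof
    assume "sq (p - 1)"
    then obtain x where "[int (p - 1) = x\<^sup>2] (mod int p)" by (auto simp: sq_def)
    then have "int p dvd x\<^sup>2 - int (p - 1)" by (simp add: cong_iff_dvd_diff dvd_diff_commute)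
    then have "int p dvd (x\<^sup>2 - int (p - 1)) + int p" by simp
    then have "int p dvd 1\<^sup>2 + x\<^sup>2" using p_gt_2 by (simp add: of_nat_diff add.commute)
    then have "int p dvd 1" by (rule dvd_sum_squares_imp_dvd)
    then show False using p_gt_2 by simp
  qed
  define m where "m = (LEAST m. \<not> sq m)"
  have m: "\<not> sq m" unfolding m_def by (rule LeastI) (rule nsq)
  have "m \<le> p - 1" unfolding m_def by (rule Least_le) (rule nsq)
  have "sq 0" "sq 1" unfolding sq_def by (auto intro: exI[of _ 0] exI[of _ 1])
  then have "m \<noteq> 0" "m \<noteq> 1" using m by metis+
  \<comment> \<open>Since \<open>1 < m < p\<close>, both \<open>m\<close> and \<open>m - 1\<close> are units.\<close>
  define a where "a = m - 1"
  have a: "m = a + 1" "0 < a" "a < p" "m < p"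
    using \<open>m \<noteq> 0\<close> \<open>m \<noteq> 1\<close> \<open>m \<le> p - 1\<close> p_gt_2 by (auto simp: a_def)
  have "sq a" using not_less_Least[of a "\<lambda>m. \<not> sq m"] a by (auto simp: m_def[symmetric])
  have red: "[x = y] (mod int p)" if "[x = y] (mod int (p ^ k))" for x y
    using that assms by (rule cong_power_imp_cong)
  have nd: "\<not> int p dvd int a" "\<not> int p dvd int m"
    using a by (auto simp only: int_dvd_int_iff dest: dvd_imp_le)
  obtain r where r: "[int a = r\<^sup>2] (mod int (p ^ k))"
  proof -
    have "\<not> [- int a = s\<^sup>2] (mod int (p ^ k))" for s
    proof
      assume "[- int a = s\<^sup>2] (mod int (p ^ k))"
      then have "[- int a = s\<^sup>2] (mod int p)" by (rule red)
      moreover obtain x where x: "[int a = x\<^sup>2] (mod int p)" using \<open>sq a\<close> by (auto simp: sq_def)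
      ultimately have "[int a + - int a = x\<^sup>2 + s\<^sup>2] (mod int p)" by (intro cong_add)
      then have "[x\<^sup>2 + s\<^sup>2 = 0] (mod int p)" by (simp only: add.right_inverse cong_sym_eq[of 0])
      then have "int p dvd x\<^sup>2 + s\<^sup>2" by (simp only: cong_0_iff)
      then have "int p dvd x" by (rule dvd_sum_squares_imp_dvd)
      then have "[x\<^sup>2 = 0] (mod int p)" by (simp add: cong_0_iff power2_eq_square)
      with x have "[int a = 0] (mod int p)" by (rule cong_trans)
      then show False using nd(1) by (simp only: cong_0_iff)
    qed
    then show ?thesis using unit_or_minus_unit_square[OF assms nd(1)] that by metis
  qed
  moreover obtain s where "[- int m = s\<^sup>2] (mod int (p ^ k))"
  proof -
    have "\<not> [int m = s\<^sup>2] (mod int (p ^ k))" for s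
      using m red[of "int m" "s\<^sup>2"] by (auto simp only: sq_def)
    then show ?thesis using unit_or_minus_unit_square[OF assms nd(2)] that by metis
  qed
  ultimately have "[int a + - int m = r\<^sup>2 + s\<^sup>2] (mod int (p ^ k))" by (rule cong_add)
  then have "[r\<^sup>2 + s\<^sup>2 = - 1] (mod int (p ^ k))" using a by (simp add: cong_sym_eq[of "- 1"])
  then show ?thesis by blast
qed

text \<open>A square \<open>s\<^sup>2\<close> is the norm of \<open>s\<close>, and \<open>- s\<^sup>2\<close> is the norm of \<open>s\<close> times an element of norm \<open>- 1\<close>.\<close>

lemma unit_sum_two_squares:
  assumes "k > 0" "\<not> int p dvd t"
  shows "\<exists>a b. [a\<^sup>2 + b\<^sup>2 = t] (mod int (p ^ k))"
proof -
  obtain s where "[t = s\<^sup>2] (mod int (p ^ k)) \<or> [- t = s\<^sup>2] (mod int (p ^ k))"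
    using unit_or_minus_unit_square[OF assms] by blast
  then show ?thesis
  proof
    assume "[t = s\<^sup>2] (mod int (p ^ k))"
    then have "[s\<^sup>2 + 0\<^sup>2 = t] (mod int (p ^ k))" by (simp add: cong_sym_eq)
    then show ?thesis by blast
  next
    assume s: "[- t = s\<^sup>2] (mod int (p ^ k))"
    obtain u v where "[u\<^sup>2 + v\<^sup>2 = - 1] (mod int (p ^ k))"
      using minus_one_sum_two_squares[OF assms(1)] by blast
    from cong_mult[OF this cong_sym[OF s]]
    have "[(u * s)\<^sup>2 + (v * s)\<^sup>2 = t] (mod int (p ^ k))" by (simp add: algebra_simps)
    then show ?thesis by blast
  qed
qed

section \<open>Counting the solutions for a unit\<close>

text \<open>Multiplication by elements of norm \<open>t\<close> and of norm \<open>1/t\<close> gives the two inequalities.\<close>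

lemma card_sols_unit_eq:
  assumes "k > 0" "\<not> int p dvd t"
  shows "card (sols t (p ^ k)) = card (sols 1 (p ^ k))"
proof -
  have pos: "p ^ k > 0" using p_gt_2 by simp
  have le: "card (sols u (p ^ k)) \<le> card (sols (c * u) (p ^ k))" if "\<not> int p dvd c" for c u
  proof -
    have "coprime c (int (p ^ k))"
      using that assms by (simp only: coprime_power_iff not_False_eq_True)
    then show ?thesis
      using unit_sum_two_squares[OF assms(1) that] card_sols_le_mult_norm[OF pos] by blast
  qed
  have "coprime t (int (p ^ k))"
    using assms by (simp only: coprime_power_iff not_False_eq_True)
  then obtain c where c: "[t * c = 1] (mod int (p ^ k))"
    using cong_solve_coprime_int by blast
  have "\<not> int p dvd c"
  proof
    assume "int p dvd c"
    moreover have "[t * c = 1] (mod int p)"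
      using c assms(1) by (rule cong_power_imp_cong)
    ultimately have "int p dvd 1" using cong_dvd_iff dvd_mult by blast
    then show False using p_gt_2 by simp
  qed
  then have "card (sols t (p ^ k)) \<le> card (sols (c * t) (p ^ k))" by (rule le)
  also have "\<dots> = card (sols 1 (p ^ k))"
    using sols_cong[OF c] by (simp add: mult.commute)
  finally show ?thesis using le[OF assms(2), of 1] by simp
qed

lemma card_multiples: "card {x \<in> {0..<int (p * m)}. int p dvd x} = m"
proof -
  have "{x \<in> {0..<int (p * m)}. int p dvd x} = (\<lambda>x. int p * x) ` {0..<int m}"
    using p_gt_2 by (auto simp: zero_le_mult_iff elim!: dvdE)
  also have "card \<dots> = card {0..<int m}"
    using p_gt_2 by (intro card_image) (auto simp: inj_on_def)
  finally show ?thesis by simp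
qed

text \<open>The pairs with a coordinate prime to \<open>p\<close> are partitioned by the value of \<open>x\<^sup>2 + y\<^sup>2\<close>, which ranges
  over the units; the parts have equal size.\<close>

lemma card_sols_unit:
  assumes "k > 0" "\<not> int p dvd t"
  shows "card (sols t (p ^ k)) = (p + 1) * p ^ (k - 1)"
proof -
  define m where "m = p ^ (k - 1)"
  have n: "p ^ k = p * m" using assms by (simp add: m_def flip: power_Suc)
  have "m > 0" using p_gt_2 by (simp add: m_def)
  define R where "R = {0..<int (p ^ k)}"
  define M where "M = {x \<in> R. int p dvd x}"
  have MR: "M \<subseteq> R" by (auto simp only: M_def)
  have fin: "finite R" "finite M" using finite_subset[OF MR] by (simp_all add: R_def)
  have card: "card R = p * m" "card M = m"
    unfolding M_def R_def n by (simp_all only: card_multiples card_atLeastLessThan_int diff_zero nat_int)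
  have "R \<times> R - M \<times> M = (\<Union>u\<in>R - M. sols u (p ^ k))"
  proof (intro equalityI subsetI, goal_cases)
    case (1 z)
    then obtain x y where z: "z = (x, y)" "x \<in> R" "y \<in> R" "\<not> int p dvd x\<^sup>2 + y\<^sup>2"
      by (auto simp: M_def dvd_sum_squares_iff)
    have "(x\<^sup>2 + y\<^sup>2) mod int (p ^ k) \<in> R - M"
      using z p_gt_2 assms(1) by (auto simp: R_def M_def dvd_mod_iff)
    moreover have "z \<in> sols ((x\<^sup>2 + y\<^sup>2) mod int (p ^ k)) (p ^ k)"
      using z by (auto simp: sols_def R_def cong_def)
    ultimately show ?case by blast
  next
    case (2 z)
    then obtain u where "u \<in> R - M" and zu: "z \<in> sols u (p ^ k)" by blast
    then have u: "\<not> int p dvd u" by (simp add: M_def)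
    obtain x y where z: "z = (x, y)" "x \<in> R" "y \<in> R" "[x\<^sup>2 + y\<^sup>2 = u] (mod int (p ^ k))"
      using zu by (auto simp: sols_def R_def)
    from z(4) have "[x\<^sup>2 + y\<^sup>2 = u] (mod int p)"
      using assms(1) by (rule cong_power_imp_cong)
    then have "\<not> int p dvd x\<^sup>2 + y\<^sup>2" using u cong_dvd_iff by blast
    then show ?case using z by (auto simp: M_def dvd_sum_squares_iff)
  qed
  moreover have "card (\<Union>u\<in>R - M. sols u (p ^ k)) = (\<Sum>u\<in>R - M. card (sols u (p ^ k)))"
  proof (rule card_UN_disjoint)
    show "\<forall>u\<in>R - M. \<forall>v\<in>R - M. u \<noteq> v \<longrightarrow> sols u (p ^ k) \<inter> sols v (p ^ k) = {}"
      by (auto simp: sols_def R_def cong_def)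
  qed (use fin in auto)
  moreover have "(\<Sum>u\<in>R - M. card (sols u (p ^ k))) = card (R - M) * card (sols t (p ^ k))"
  proof -
    have "card (sols u (p ^ k)) = card (sols t (p ^ k))" if "u \<in> R - M" for u
      using that card_sols_unit_eq[OF assms(1)] assms(2) by (auto simp: M_def)
    then show ?thesis by simp
  qed
  ultimately have "card (R - M) * card (sols t (p ^ k)) = card (R \<times> R - M \<times> M)" by (simp only:)
  also have "\<dots> = (p * m)\<^sup>2 - m\<^sup>2"
    using MR fin card by (subst card_Diff_subset) (auto simp: card_cartesian_product power2_eq_square)
  also have "\<dots> = (p * m - m) * ((p + 1) * m)"
  proof -
    obtain q where "p = Suc q" using p_gt_2 by (cases p) auto
    then show ?thesis by (simp add: power2_eq_square algebra_simps)
  qed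
  also have "card (R - M) = p * m - m"
    using MR fin card by (simp add: card_Diff_subset)
  finally have "(p * m - m) * card (sols t (p ^ k)) = (p * m - m) * ((p + 1) * m)" .
  moreover have "p * m - m > 0" using p_gt_2 \<open>m > 0\<close> by simp
  ultimately show ?thesis by (simp add: m_def)
qed

section \<open>Dividing by the square of the prime\<close>

text \<open>Every solution for \<open>p\<^sup>2 s\<close> is \<open>p\<close> times a pair \<open>(a, b)\<close> with \<open>a\<^sup>2 + b\<^sup>2 \<equiv> s (mod n)\<close> and \<open>0 \<le> a, b < p n\<close>.
  This condition only depends on \<open>a\<close> and \<open>b\<close> modulo \<open>n\<close>, so each solution modulo \<open>n\<close> accounts for the
  \<open>p\<^sup>2\<close> pairs obtained by shifting its coordinates by \<open>n i\<close> and \<open>n j\<close> with \<open>0 \<le> i, j < p\<close>.\<close>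

lemma card_sols_scale:
  assumes "n > 0"
  shows "card (sols ((int p)\<^sup>2 * s) (p\<^sup>2 * n)) = p\<^sup>2 * card (sols s n)"
proof -
  define I where "I = {0..<int p} \<times> {0..<int p}"
  define f where "f = (\<lambda>((x, y), (i, j)). (int p * (x + int n * i), int p * (y + int n * j)))"
  have p0: "int p > 0" and n0: "int n > 0" using p_gt_2 assms by auto
  have uniq: "x = x' \<and> i = i'" if "x + int n * i = x' + int n * i'"
    "x \<in> {0..<int n}" "x' \<in> {0..<int n}" for x x' i i'
  proof -
    have "(x + int n * i) mod int n = (x' + int n * i') mod int n" using that by simp
    then have "x = x'" using that(2,3) by simp
    then show ?thesis using that n0 by simp
  qed
  have cancel: "[(int p * a)\<^sup>2 + (int p * b)\<^sup>2 = (int p)\<^sup>2 * s] (mod int (p\<^sup>2 * n)) \<longleftrightarrow>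
      [a\<^sup>2 + b\<^sup>2 = s] (mod int n)" for a b
  proof -
    have "(int p * a)\<^sup>2 + (int p * b)\<^sup>2 - (int p)\<^sup>2 * s = (int p)\<^sup>2 * (a\<^sup>2 + b\<^sup>2 - s)"
      by (simp add: power2_eq_square algebra_simps)
    then show ?thesis using p0 by (simp add: cong_iff_dvd_diff)
  qed
  have shift: "[(x + int n * i)\<^sup>2 + (y + int n * j)\<^sup>2 = s] (mod int n) \<longleftrightarrow> [x\<^sup>2 + y\<^sup>2 = s] (mod int n)"
    for x y i j
  proof -
    have "[(x + int n * i)\<^sup>2 + (y + int n * j)\<^sup>2 = x\<^sup>2 + y\<^sup>2] (mod int n)"
      by (intro cong_add cong_pow) (simp_all add: cong_def)
    then show ?thesis by (simp only: cong_def)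
  qed
  have range: "int p * (x + int n * i) \<in> {0..<int (p\<^sup>2 * n)}"
    if "x \<in> {0..<int n}" "i \<in> {0..<int p}" for x i
  proof -
    have "int n * i \<le> int n * (int p - 1)" using that by (intro mult_left_mono) auto
    then have "x + int n * i < int n * int p" using that by (simp add: algebra_simps)
    then have "int p * (x + int n * i) < int p * (int n * int p)" using p0 by simp
    then show ?thesis using that by (simp add: power2_eq_square mult_ac)
  qed
  have "bij_betw f (sols s n \<times> I) (sols ((int p)\<^sup>2 * s) (p\<^sup>2 * n))"
  proof (rule bij_betw_imageI)
    show "inj_on f (sols s n \<times> I)"
    proof (rule inj_onI)
      fix z w assume "z \<in> sols s n \<times> I" "w \<in> sols s n \<times> I" "f z = f w"
      moreover obtain x y i j where z: "z = ((x, y), (i, j))" by (metis surj_pair)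
      moreover obtain x' y' i' j' where w: "w = ((x', y'), (i', j'))" by (metis surj_pair)
      ultimately have sol: "(x, y) \<in> sols s n" "(x', y') \<in> sols s n"
        and "f ((x, y), (i, j)) = f ((x', y'), (i', j'))" by simp_all
      then have "x + int n * i = x' + int n * i'" "y + int n * j = y' + int n * j'"
        using p0 by (simp_all add: f_def)
      moreover have "x \<in> {0..<int n}" "y \<in> {0..<int n}" "x' \<in> {0..<int n}" "y' \<in> {0..<int n}"
        using sol unfolding sols_def by blast+
      ultimately have "x = x' \<and> i = i'" "y = y' \<and> j = j'"
        using uniq by blast+
      then show "z = w" using z w by simp
    qed
    show "f ` (sols s n \<times> I) = sols ((int p)\<^sup>2 * s) (p\<^sup>2 * n)"
    proof (intro equalityI subsetI)
      fix z assume "z \<in> f ` (sols s n \<times> I)"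
      then obtain x y i j where z: "z = (int p * (x + int n * i), int p * (y + int n * j))"
        and *: "(x, y) \<in> sols s n" "i \<in> {0..<int p}" "j \<in> {0..<int p}"
        by (auto simp: f_def I_def)
      show "z \<in> sols ((int p)\<^sup>2 * s) (p\<^sup>2 * n)"
        using * range[of x i] range[of y j] unfolding z sols_def
        by (simp only: mem_Collect_eq prod.case cancel shift)
    next
      fix z assume z: "z \<in> sols ((int p)\<^sup>2 * s) (p\<^sup>2 * n)"
      obtain X Y where XY: "z = (X, Y)" by fastforce
      have cong: "[X\<^sup>2 + Y\<^sup>2 = (int p)\<^sup>2 * s] (mod int (p\<^sup>2 * n))"
        using z by (simp add: XY sols_def)
      then have "[X\<^sup>2 + Y\<^sup>2 = (int p)\<^sup>2 * s] (mod int p)"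
        by (rule cong_dvd_modulus) (simp add: power2_eq_square)
      then have "int p dvd X\<^sup>2 + Y\<^sup>2" by (simp add: cong_dvd_iff power2_eq_square)
      then obtain a b where ab: "X = int p * a" "Y = int p * b"
        unfolding dvd_sum_squares_iff by (elim conjE dvdE)
      have quot: "c mod int n \<in> {0..<int n} \<and> c div int n \<in> {0..<int p}"
        if "int p * c \<in> {0..<int (p\<^sup>2 * n)}" for c
      proof -
        have "int p * c < int p * (int p * int n)" using that by (simp add: power2_eq_square mult_ac)
        then have "c < int p * int n" using p0 by simp
        moreover have "int n * (c div int n) \<le> c"
          using mult_div_mod_eq[of "int n" c] pos_mod_sign[OF n0, of c] by linarith
        ultimately have "int n * (c div int n) < int n * int p" by (simp add: mult.commute)
        then have "c div int n < int p" using n0 by simp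
        moreover have "0 \<le> c" using that p0 by (simp add: zero_le_mult_iff)
        ultimately show ?thesis
          using n0 by (simp add: pos_imp_zdiv_nonneg_iff)
      qed
      have q: "a mod int n \<in> {0..<int n} \<and> a div int n \<in> {0..<int p}"
        "b mod int n \<in> {0..<int n} \<and> b div int n \<in> {0..<int p}"
        using z quot unfolding XY ab sols_def mem_Collect_eq prod.case by simp_all
      have "[a\<^sup>2 + b\<^sup>2 = s] (mod int n)" using cong unfolding ab cancel .
      then have "[(a mod int n)\<^sup>2 + (b mod int n)\<^sup>2 = s] (mod int n)"
        using shift[of "a mod int n" "a div int n" "b mod int n" "b div int n"] by simp
      then have "((a mod int n, b mod int n), (a div int n, b div int n)) \<in> sols s n \<times> I"
        using q by (simp add: sols_def I_def)
      moreover have "z = f ((a mod int n, b mod int n), (a div int n, b div int n))"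
        by (simp add: f_def XY ab)
      ultimately show "z \<in> f ` (sols s n \<times> I)" by blast
    qed
  qed
  then have "card (sols ((int p)\<^sup>2 * s) (p\<^sup>2 * n)) = card (sols s n \<times> I)"
    by (simp add: bij_betw_same_card)
  then show ?thesis by (simp add: card_cartesian_product I_def power2_eq_square)
qed

lemma card_sols_zero: "card (sols 0 (p ^ k)) = p ^ (2 * (k div 2))"
proof (induction k rule: induct_nat_012)
  case 0
  have "sols 0 1 = {(0, 0)}" by (auto simp: sols_def)
  then show ?case by simp
next
  case 1
  have small: "x = 0" if "int p dvd x" "0 \<le> x" "x < int p" for x
    using that zdvd_not_zless[of x "int p"] by linarith
  have "x = 0 \<and> y = 0" if "(x, y) \<in> sols 0 p" for x y
    using that small by (auto simp: sols_def cong_0_iff dvd_sum_squares_iff)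
  then have "sols 0 p = {(0, 0)}"
    using p_gt_2 by (auto simp: sols_def)
  then show ?case by simp
next
  case (ge2 k)
  then show ?case
    using card_sols_scale[of "p ^ k" 0] p_gt_2 by (simp add: power2_eq_square mult_ac)
qed

text \<open>Induction in steps of two on the exponent. For exponent \<open>1\<close> there is no solution: \<open>p\<close> divides
  \<open>x\<^sup>2 + y\<^sup>2\<close>, hence so does \<open>p\<^sup>2\<close>, whereas \<open>p\<^sup>2\<close> divides the modulus but not \<open>p b\<close>.\<close>

lemma card_sols_prime_power_mult:
  assumes "\<not> int p dvd b" "a < k"
  shows "card (sols (int p ^ a * b) (p ^ k)) = (if even a then (p + 1) * p ^ (k - 1) else 0)"
  using assms(2)
proof (induction a arbitrary: k rule: induct_nat_012)
  case 0
  then show ?case using card_sols_unit[OF _ assms(1)] by simp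
next
  case 1
  have "sols (int p * b) (p ^ k) = {}"
  proof -
    have False if "(x, y) \<in> sols (int p * b) (p ^ k)" for x y
    proof -
      have "p\<^sup>2 dvd p ^ k" using 1 by (intro le_imp_power_dvd) auto
      then have "int (p\<^sup>2) dvd int (p ^ k)" by (simp only: int_dvd_int_iff)
      with that have cong: "[x\<^sup>2 + y\<^sup>2 = int p * b] (mod (int p)\<^sup>2)"
        by (auto simp: sols_def intro: cong_dvd_modulus)
      then have "[x\<^sup>2 + y\<^sup>2 = int p * b] (mod int p)"
        by (rule cong_dvd_modulus) (simp add: power2_eq_square)
      then have "int p dvd x\<^sup>2 + y\<^sup>2" by (simp add: cong_dvd_iff)
      then have "(int p)\<^sup>2 dvd x\<^sup>2 + y\<^sup>2"
        unfolding dvd_sum_squares_iff by (intro dvd_add dvd_power_same) auto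
      then have "[x\<^sup>2 + y\<^sup>2 = 0] (mod (int p)\<^sup>2)" by (simp only: cong_0_iff)
      with cong_sym[OF cong] have "[int p * b = 0] (mod (int p)\<^sup>2)" by (rule cong_trans)
      then have "(int p)\<^sup>2 dvd int p * b" by (simp only: cong_0_iff)
      then show False using assms(1) p_gt_2 by (simp add: power2_eq_square)
    qed
    then show ?thesis by auto
  qed
  then show ?case by simp
next
  case (ge2 a)
  define l where "l = k - 2"
  then have l: "k = l + 2" "a < l" using ge2.prems by simp_all
  have "card (sols (int p ^ Suc (Suc a) * b) (p ^ k)) = p\<^sup>2 * card (sols (int p ^ a * b) (p ^ l))"
    using card_sols_scale[of "p ^ l" "int p ^ a * b"] p_gt_2
    by (simp add: l power2_eq_square mult_ac)
  also have "\<dots> = (if even a then (p + 1) * p ^ (k - 1) else 0)"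
    using ge2.IH(1)[OF l(2)] l by (cases l) (auto simp: power2_eq_square mult_ac)
  finally show ?case by simp
qed

end

theorem theorem1p10:
  fixes p k \<alpha> :: nat and t \<beta> :: int
  assumes "prime p" and "odd p" and "[p = 3] (mod 4)"
    and "k \<ge> 1"
    and "t \<in> carrier (residue_ring (int (p ^ k)))"
    and "t \<noteq> 0 \<Longrightarrow> t = int p ^ \<alpha> * \<beta> \<and> \<not> int p dvd \<beta> \<and> \<alpha> < k"
  shows "N2 t (p ^ k) =
    (if t = 0 then p ^ (2 * (k div 2))
     else if even \<alpha> then (p + 1) * p ^ (k - 1)
     else 0)"
proof -
  interpret prime_3_mod_4 p using assms by unfold_locales
  show ?thesis
  proof (cases "t = 0")
    case True
    then show ?thesis by (simp add: N2_eq_card_sols card_sols_zero)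
  next
    case False
    with assms(6) have "t = int p ^ \<alpha> * \<beta>" "\<not> int p dvd \<beta>" "\<alpha> < k" by simp_all
    then have "N2 t (p ^ k) = (if even \<alpha> then (p + 1) * p ^ (k - 1) else 0)"
      by (simp only: N2_eq_card_sols card_sols_prime_power_mult not_False_eq_True)
    with False show ?thesis by (simp only: if_False)
  qed
qed

end
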